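(* Let $n\ge 1$, let $\mathbb{K}=\bigcup_{q\ge 1}\mathbb{C}((t^{1/q}))$ be the field of Puiseux series over $\mathbb{C}$, and let $\widetilde{f}=\sum_{i\in I}\widetilde{a}_i x^i\in\mathbb{K}[x_1,\ldots,x_n]$ be a nonzero polynomial, where $I\subset\mathbb{Z}_{\ge 0}^n$ is the finite nonempty set of exponents with $\widetilde{a}_i\neq 0$. Let $(\gamma_1,\ldots,\gamma_n)\in(\mathbb{C}^* )^n$ and $b=(b_1,\ldots,b_n)\in\mathbb{Q}^n$. Then there exists a point $\widetilde{b}=(\widetilde{b}_1,\ldots,\widetilde{b}_n)\in(\mathbb{K}^* )^n$ with $\widetilde{f}(\widetilde{b}_1,\ldots,\widetilde{b}_n)=0$ and with $pc(\widetilde{b}_j)=\gamma_j$ and $o(\widetilde{b}_j)=b_j$ for all $1\le j\le n$ if and only if $b\in\mathcal{T}(f)$ and $\widetilde{f}_b(\gamma_1,\ldots,\gamma_n)=0$.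
   Context: Every element of $\mathbb{K}$ is written as $\widetilde{a}=\sum_{m=k}^{\infty}\alpha_m t^{m/q}$ with $k\in\mathbb{Z}$, $q\in\mathbb{Z}_{\geq 1}$, $\alpha_m\in\mathbb{C}$. For $\widetilde{a}\ne 0$, the order $o(\widetilde{a})\in\mathbb{Q}$ is the smallest exponent of $t$ occurring in $\widetilde{a}$ with nonzero coefficient, and the principal coefficient $pc(\widetilde{a})\in\mathbb{C}^*$ is the coefficient of $t^{o(\widetilde{a})}$ in $\widetilde{a}$; also $o(0)=\infty$. For $i=(i_1,\ldots,i_n)\in\mathbb{Z}_{\ge 0}^n$, write $x^i=x_1^{i_1}\cdots x_n^{i_n}$, and for $r=(r_1,\ldots,r_n)\in\mathbb{Q}^n$ write $ir=i_1r_1+\cdots+i_nr_n$. For $\widetilde{f}=\sum_{i\in I}\widetilde{a}_ix^i$ with all $\widetilde{a}_i\neq 0$ for $i\in I$, put $a_i=o(\widetilde{a}_i)\in\mathbb{Q}$ and $\alpha_i=pc(\widetilde{a}_i)\in\mathbb{C}^*$. The associated piecewise affine function is $f(r)=\min_{i\in I}\{a_i+ir\}$ for $r\in\mathbb{Q}^n$. The set $\mathcal{T}(f)\subseteq\mathbb{Q}^n$ is the set of all $r\in\mathbb{Q}^n$ such that the minimum $f(r)$ is attained for at least two different indices $i\in I$. For $b\in\mathbb{Q}^n$, define the polynomial over $\mathbb{C}$ $$\widetilde{f}_b(x_1,\ldots,x_n)=\sum_{i\in I,\ a_i+ib=f(b)}\alpha_i x^i\in\mathbb{C}[x_1,\ldots,x_n].$$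 *)

theory Defs
  imports Complex_Main
    "HOL-Computational_Algebra.Formal_Laurent_Series"
    "HOL-Library.Poly_Mapping"
begin

section \<open>The field of Puiseux series\<close>

text \<open>
  A Puiseux series is represented by its coefficient function on rational exponents: the support
  lies in \<open>{m / q | m. m \<ge> k}\<close> for some positive integer \<open>q\<close> and some integer \<open>k\<close>.
\<close>

typedef (overloaded) 'a puiseux =
  "{c :: rat \<Rightarrow> 'a::zero. \<exists>q::nat. \<exists>k::int. q > 0 \<and>
      (\<forall>r. c r \<noteq> 0 \<longrightarrow> (\<exists>m\<ge>k. r = of_int m / of_nat q))}"
  morphisms puiseux_coeff Abs_puiseux
  by (rule exI[of _ "\<lambda>_. 0"]) auto

setup_lifting type_definition_puiseux

lemma puiseux_eqI: "(\<And>r. puiseux_coeff p r = puiseux_coeff s r) \<Longrightarrow> p = s"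
  by transfer auto

text \<open>
  The substitution \<open>t \<mapsto> t powr (1 / q)\<close>, an isomorphism from Laurent series in \<open>t\<close> to Laurent
  series in \<open>t powr (1 / q)\<close> for \<open>q > 0\<close>.
\<close>

lift_definition puiseux_of_fls :: "nat \<Rightarrow> 'a::zero fls \<Rightarrow> 'a puiseux" is
  "\<lambda>q F r. if q > 0 \<and> r * of_nat q \<in> \<int> then fls_nth F \<lfloor>r * of_nat q\<rfloor> else 0"
proof -
  fix q :: nat and F :: "'a fls"
  obtain N where N: "\<forall>n<N. fls_nth F n = 0"
    by (rule fls_nth_vanishes_belowE)
  show "\<exists>q' k. (0::nat) < q' \<and> (\<forall>r::rat.
      (if q > 0 \<and> r * of_nat q \<in> \<int> then fls_nth F \<lfloor>r * of_nat q\<rfloor> else 0) \<noteq> 0 \<longrightarrow>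
      (\<exists>m\<ge>k. r = of_int m / of_nat q'))"
  proof (cases "q > 0")
    case True
    have "\<exists>m\<ge>N. r = of_int m / of_nat q"
      if r: "r * of_nat q \<in> \<int>" "fls_nth F \<lfloor>r * of_nat q\<rfloor> \<noteq> 0" for r :: rat
    proof -
      from r(1) obtain m where m: "r * of_nat q = of_int m" by (auto elim: Ints_cases)
      with r(2) N have "m \<ge> N" by (metis floor_of_int not_le)
      moreover from m True have "r = of_int m / of_nat q" by (simp add: field_simps)
      ultimately show ?thesis by blast
    qed
    with True show ?thesis by (intro exI[of _ q] exI[of _ N]) auto
  qed (auto intro: exI[of _ 1])
qed

lemma puiseux_of_fls_coeff:
  "q > 0 \<Longrightarrow> puiseux_coeff (puiseux_of_fls q F) r =
     (if r * of_nat q \<in> \<int> then fls_nth F \<lfloor>r * of_nat q\<rfloor> else 0)"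
  by (simp add: puiseux_of_fls.rep_eq)

lemma puiseux_of_fls_coeff':
  "q > 0 \<Longrightarrow> puiseux_coeff (puiseux_of_fls q F) (of_int m / of_nat q) = fls_nth F m"
  by (simp add: puiseux_of_fls_coeff)

lemma puiseux_of_fls_inj: "q > 0 \<Longrightarrow> puiseux_of_fls q F = puiseux_of_fls q G \<Longrightarrow> F = G"
  by (metis fls_eqI puiseux_of_fls_coeff')

lemma puiseux_of_fls_surj:
  assumes q: "q > 0"
    and supp: "\<And>r. puiseux_coeff p r \<noteq> 0 \<Longrightarrow> \<exists>m\<ge>k. r = of_int m / of_nat q"
  shows "\<exists>F. p = puiseux_of_fls q F"
proof -
  define F where "F = Abs_fls (\<lambda>m. puiseux_coeff p (of_int m / of_nat q))"
  have "puiseux_coeff p (of_int m / of_nat q) = 0" if "m < k" for m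
  proof (rule ccontr)
    assume "puiseux_coeff p (of_int m / of_nat q) \<noteq> 0"
    from supp[OF this] obtain m' where
      m': "m' \<ge> k" "of_int m / of_nat q = (of_int m' / of_nat q :: rat)" by blast
    from m'(2) q have "m = m'" by simp
    with m' that show False by simp
  qed
  then have F: "fls_nth F m = puiseux_coeff p (of_int m / of_nat q)" for m
    unfolding F_def by (intro nth_Abs_fls_lower_bound[of k]) auto
  have "p = puiseux_of_fls q F"
  proof (rule puiseux_eqI)
    fix r
    show "puiseux_coeff p r = puiseux_coeff (puiseux_of_fls q F) r"
    proof (cases "r * of_nat q \<in> \<int>")
      case True
      then obtain m where "r * of_nat q = of_int m" by (auto elim: Ints_cases)
      with q have "r = of_int m / of_nat q" by (simp add: field_simps)
      then show ?thesis by (simp add: puiseux_of_fls_coeff' q F)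
    next
      case False
      have "puiseux_coeff p r = 0"
      proof (rule ccontr)
        assume "puiseux_coeff p r \<noteq> 0"
        from supp[OF this] q have "r * of_nat q \<in> \<int>" by auto
        with False show False ..
      qed
      with False q show ?thesis by (simp add: puiseux_of_fls_coeff)
    qed
  qed
  then show ?thesis ..
qed

lemma support_scale:
  fixes r :: rat
  assumes "d > 0" "q > (0::nat)" "\<exists>m\<ge>k. r = of_int m / of_nat q"
  shows "\<exists>m\<ge>k * int d. r = of_int m / of_nat (q * d)"
proof -
  from assms(3) obtain m where m: "m \<ge> k" "r = of_int m / of_nat q" by blast
  then have "m * int d \<ge> k * int d" "r = of_int (m * int d) / of_nat (q * d)"
    using assms(1,2) by (auto intro: mult_right_mono)
  then show ?thesis by blast
qed

lemma puiseux_as_fls3: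
  obtains q F G H where "q > 0"
    "p = puiseux_of_fls q F" "s = puiseux_of_fls q G" "u = puiseux_of_fls q H"
proof -
  obtain q1 k1 where 1: "q1 > 0" "\<And>r. puiseux_coeff p r \<noteq> 0 \<Longrightarrow> \<exists>m\<ge>k1. r = of_int m / of_nat q1"
    using puiseux_coeff[of p] by blast
  obtain q2 k2 where 2: "q2 > 0" "\<And>r. puiseux_coeff s r \<noteq> 0 \<Longrightarrow> \<exists>m\<ge>k2. r = of_int m / of_nat q2"
    using puiseux_coeff[of s] by blast
  obtain q3 k3 where 3: "q3 > 0" "\<And>r. puiseux_coeff u r \<noteq> 0 \<Longrightarrow> \<exists>m\<ge>k3. r = of_int m / of_nat q3"
    using puiseux_coeff[of u] by blast
  define q where "q = q1 * q2 * q3"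
  have q: "q > 0" using 1 2 3 by (simp add: q_def)
  have "\<exists>F. p = puiseux_of_fls q F"
  proof (rule puiseux_of_fls_surj[OF q])
    fix r assume "puiseux_coeff p r \<noteq> 0"
    from support_scale[OF _ 1(1) 1(2)[OF this], of "q2 * q3"] 2 3
    show "\<exists>m\<ge>k1 * int (q2 * q3). r = of_int m / of_nat q" by (simp add: q_def ac_simps)
  qed
  moreover have "\<exists>F. s = puiseux_of_fls q F"
  proof (rule puiseux_of_fls_surj[OF q])
    fix r assume "puiseux_coeff s r \<noteq> 0"
    from support_scale[OF _ 2(1) 2(2)[OF this], of "q1 * q3"] 1 3
    show "\<exists>m\<ge>k2 * int (q1 * q3). r = of_int m / of_nat q" by (simp add: q_def ac_simps)
  qed
  moreover have "\<exists>F. u = puiseux_of_fls q F"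
  proof (rule puiseux_of_fls_surj[OF q])
    fix r assume "puiseux_coeff u r \<noteq> 0"
    from support_scale[OF _ 3(1) 3(2)[OF this], of "q1 * q2"] 1 2
    show "\<exists>m\<ge>k3 * int (q1 * q2). r = of_int m / of_nat q" by (simp add: q_def ac_simps)
  qed
  ultimately show ?thesis using q that by blast
qed

subsection \<open>Ring operations\<close>

instantiation puiseux :: (zero) zero
begin
lift_definition zero_puiseux :: "'a puiseux" is "\<lambda>_. 0"
  by (auto intro: exI[of _ 1])
instance ..
end

instantiation puiseux :: (zero_neq_one) one
begin
lift_definition one_puiseux :: "'a puiseux" is "\<lambda>r. if r = 0 then 1 else 0"
  by (rule exI[of _ 1], rule exI[of _ 0]) auto
instance ..
end

lemma puiseux_coeff_0 [simp]: "puiseux_coeff 0 r = 0"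
  by transfer simp

lemma puiseux_coeff_1: "puiseux_coeff 1 r = (if r = 0 then 1 else 0)"
  by transfer simp

lemma puiseux_of_fls_0: "0 = puiseux_of_fls q 0"
  by (rule puiseux_eqI) (simp add: puiseux_of_fls.rep_eq)

lemma puiseux_of_fls_1: "q > 0 \<Longrightarrow> 1 = puiseux_of_fls q 1"
  by (rule puiseux_eqI) (auto simp: puiseux_coeff_1 puiseux_of_fls_coeff elim!: Ints_cases)

instantiation puiseux :: (comm_monoid_add) plus
begin
lift_definition plus_puiseux :: "'a puiseux \<Rightarrow> 'a puiseux \<Rightarrow> 'a puiseux" is
  "\<lambda>c d r. c r + d r"
proof -
  fix c d :: "rat \<Rightarrow> 'a"
  assume "\<exists>q k. (0::nat) < q \<and> (\<forall>r. c r \<noteq> 0 \<longrightarrow> (\<exists>m\<ge>k. r = of_int m / of_nat q))"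
    and "\<exists>q k. (0::nat) < q \<and> (\<forall>r. d r \<noteq> 0 \<longrightarrow> (\<exists>m\<ge>k. r = of_int m / of_nat q))"
  then obtain q1 k1 q2 k2 where q: "(0::nat) < q1" "(0::nat) < q2"
    and c: "\<And>r. c r \<noteq> 0 \<Longrightarrow> \<exists>m\<ge>k1. r = of_int m / of_nat q1"
    and d: "\<And>r. d r \<noteq> 0 \<Longrightarrow> \<exists>m\<ge>k2. r = of_int m / of_nat q2" by blast
  have "\<exists>m\<ge>min (k1 * int q2) (k2 * int q1). r = of_int m / of_nat (q1 * q2)"
    if "c r + d r \<noteq> 0" for r
  proof -
    from that have "c r \<noteq> 0 \<or> d r \<noteq> 0" by auto
    then show ?thesis
    proof
      assume "c r \<noteq> 0"
      from support_scale[OF q(2,1) c[OF this]] show ?thesis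
        using order_trans[OF min.cobounded1] by blast
    next
      assume "d r \<noteq> 0"
      from support_scale[OF q(1,2) d[OF this]]
      have "\<exists>m\<ge>k2 * int q1. r = of_int m / of_nat (q1 * q2)" by (simp only: mult.commute)
      then show ?thesis using order_trans[OF min.cobounded2] by blast
    qed
  qed
  with q show "\<exists>q k. (0::nat) < q \<and> (\<forall>r. c r + d r \<noteq> 0 \<longrightarrow> (\<exists>m\<ge>k. r = of_int m / of_nat q))"
    by (intro exI[of _ "q1 * q2"] exI[of _ "min (k1 * int q2) (k2 * int q1)"]) auto
qed
instance ..
end

instantiation puiseux :: (ab_group_add) "{uminus, minus}"
begin
lift_definition uminus_puiseux :: "'a puiseux \<Rightarrow> 'a puiseux" is "\<lambda>c r. - c r"
  by simp
definition minus_puiseux :: "'a puiseux \<Rightarrow> 'a puiseux \<Rightarrow> 'a puiseux" where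
  "minus_puiseux p s = p + (- s)"
instance ..
end

lemma puiseux_coeff_add [simp]:
  "puiseux_coeff (p + s) r = puiseux_coeff p r + puiseux_coeff s r"
  by transfer simp

lemma puiseux_coeff_uminus [simp]: "puiseux_coeff (- p) r = - puiseux_coeff p r"
  by transfer simp

lemma puiseux_coeff_diff [simp]:
  "puiseux_coeff (p - s) r = puiseux_coeff p r - puiseux_coeff s r"
  by (simp add: minus_puiseux_def)

lemma puiseux_of_fls_add: "puiseux_of_fls q F + puiseux_of_fls q G = puiseux_of_fls q (F + G)"
  by (rule puiseux_eqI) (simp add: puiseux_of_fls.rep_eq)

text \<open>
  The product is the Cauchy product; the index set of the sum is finite because both supports are
  discrete and bounded below.
\<close>

instantiation puiseux :: ("{comm_monoid_add, times}") times
begin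
lift_definition times_puiseux :: "'a puiseux \<Rightarrow> 'a puiseux \<Rightarrow> 'a puiseux" is
  "\<lambda>c d r. \<Sum>s | c s \<noteq> 0 \<and> d (r - s) \<noteq> 0. c s * d (r - s)"
proof -
  fix c d :: "rat \<Rightarrow> 'a"
  assume "\<exists>q k. (0::nat) < q \<and> (\<forall>r. c r \<noteq> 0 \<longrightarrow> (\<exists>m\<ge>k. r = of_int m / of_nat q))"
    and "\<exists>q k. (0::nat) < q \<and> (\<forall>r. d r \<noteq> 0 \<longrightarrow> (\<exists>m\<ge>k. r = of_int m / of_nat q))"
  then obtain q1 k1 q2 k2 where q: "(0::nat) < q1" "(0::nat) < q2"
    and c: "\<And>r. c r \<noteq> 0 \<Longrightarrow> \<exists>m\<ge>k1. r = of_int m / of_nat q1"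
    and d: "\<And>r. d r \<noteq> 0 \<Longrightarrow> \<exists>m\<ge>k2. r = of_int m / of_nat q2" by blast
  have "\<exists>m\<ge>k1 * int q2 + k2 * int q1. r = of_int m / of_nat (q1 * q2)"
    if "(\<Sum>s | c s \<noteq> 0 \<and> d (r - s) \<noteq> 0. c s * d (r - s)) \<noteq> 0" for r
  proof -
    from that have "{s. c s \<noteq> 0 \<and> d (r - s) \<noteq> 0} \<noteq> {}" by (metis sum.empty)
    then obtain s where "c s \<noteq> 0" "d (r - s) \<noteq> 0" by blast
    with c d obtain m1 m2 where m: "m1 \<ge> k1" "s = of_int m1 / of_nat q1"
      "m2 \<ge> k2" "r - s = of_int m2 / of_nat q2" by meson
    then have "r = of_int m1 / of_nat q1 + of_int m2 / of_nat q2" by (simp add: algebra_simps)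
    also have "\<dots> = of_int (m1 * int q2 + m2 * int q1) / of_nat (q1 * q2)"
      using q by (simp add: field_simps)
    finally have "r = \<dots>" .
    moreover have "m1 * int q2 + m2 * int q1 \<ge> k1 * int q2 + k2 * int q1"
      using m by (intro add_mono mult_right_mono) auto
    ultimately show ?thesis by blast
  qed
  with q show "\<exists>q k. (0::nat) < q \<and> (\<forall>r. (\<Sum>s | c s \<noteq> 0 \<and> d (r - s) \<noteq> 0. c s * d (r - s)) \<noteq> 0 \<longrightarrow>
      (\<exists>m\<ge>k. r = of_int m / of_nat q))"
    by (intro exI[of _ "q1 * q2"] exI[of _ "k1 * int q2 + k2 * int q1"]) auto
qed
instance ..
end

lemma puiseux_coeff_mult:
  "puiseux_coeff (p * u) r =
     (\<Sum>s | puiseux_coeff p s \<noteq> 0 \<and> puiseux_coeff u (r - s) \<noteq> 0.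
        puiseux_coeff p s * puiseux_coeff u (r - s))"
  by transfer simp

lemma puiseux_of_fls_mult:
  fixes F G :: "'a::semiring_0 fls"
  assumes q: "q > 0"
  shows "puiseux_of_fls q F * puiseux_of_fls q G = puiseux_of_fls q (F * G)"
proof (rule puiseux_eqI)
  fix r :: rat
  let ?p = "puiseux_coeff (puiseux_of_fls q F)" and ?u = "puiseux_coeff (puiseux_of_fls q G)"
  let ?S = "{s. ?p s \<noteq> 0 \<and> ?u (r - s) \<noteq> 0}"
  let ?h = "\<lambda>i::int. of_int i / (of_nat q :: rat)"
  have S: "s * of_nat q \<in> \<int>" "(r - s) * of_nat q \<in> \<int>" if "s \<in> ?S" for s
    using that q by (auto simp: puiseux_of_fls_coeff split: if_splits)
  show "puiseux_coeff (puiseux_of_fls q F * puiseux_of_fls q G) r =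
      puiseux_coeff (puiseux_of_fls q (F * G)) r"
  proof (cases "r * of_nat q \<in> \<int>")
    case False
    have "?S = {}"
    proof (rule ccontr)
      assume "?S \<noteq> {}"
      then obtain s where "s \<in> ?S" by blast
      from Ints_add[OF S[OF this]] False show False by (simp add: algebra_simps)
    qed
    then have "puiseux_coeff (puiseux_of_fls q F * puiseux_of_fls q G) r = 0"
      by (simp only: puiseux_coeff_mult sum.empty)
    with False q show ?thesis by (simp add: puiseux_of_fls_coeff)
  next
    case True
    then obtain n where "r * of_nat q = of_int n" by (auto elim: Ints_cases)
    with q have r: "r = ?h n" by (simp add: field_simps)
    have p: "?p (?h i) = fls_nth F i" for i by (rule puiseux_of_fls_coeff'[OF q])
    have "r - ?h i = ?h (n - i)" for i by (simp add: r diff_divide_distrib)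
    then have u: "?u (r - ?h i) = fls_nth G (n - i)" for i
      by (simp only: puiseux_of_fls_coeff'[OF q])
    let ?I = "{i. fls_nth F i \<noteq> 0 \<and> fls_nth G (n - i) \<noteq> 0}"
    have "?S = ?h ` ?I"
    proof (intro equalityI subsetI)
      fix s assume s: "s \<in> ?S"
      from S(1)[OF s] obtain i where "s * of_nat q = of_int i" by (elim Ints_cases)
      with q have i: "s = ?h i" by (simp add: field_simps)
      from s have "?p (?h i) \<noteq> 0 \<and> ?u (r - ?h i) \<noteq> 0" unfolding i by blast
      then have "i \<in> ?I" unfolding p u by blast
      with i show "s \<in> ?h ` ?I" by blast
    next
      fix s assume "s \<in> ?h ` ?I"
      then obtain i where "i \<in> ?I" "s = ?h i" by blast
      then have "?p s \<noteq> 0 \<and> ?u (r - s) \<noteq> 0" using p u by auto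
      then show "s \<in> ?S" by blast
    qed
    moreover have "inj_on ?h ?I" using q by (auto intro!: inj_onI)
    ultimately have "(\<Sum>s\<in>?S. ?p s * ?u (r - s)) = (\<Sum>i\<in>?I. fls_nth F i * fls_nth G (n - i))"
      by (simp only: sum.reindex p u o_def)
    also have "\<dots> = (\<Sum>i=fls_subdegree F..n - fls_subdegree G. fls_nth F i * fls_nth G (n - i))"
    proof (rule sum.mono_neutral_left)
      show "?I \<subseteq> {fls_subdegree F..n - fls_subdegree G}"
      proof
        fix i assume "i \<in> ?I"
        then have "fls_subdegree F \<le> i" "fls_subdegree G \<le> n - i"
          by (auto intro: fls_subdegree_leI)
        then show "i \<in> {fls_subdegree F..n - fls_subdegree G}" by auto
      qed
    qed auto
    also have "\<dots> = fls_nth (F * G) n" by (rule fls_times_nth(2)[symmetric])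
    finally show ?thesis
      by (simp only: puiseux_coeff_mult) (simp only: r puiseux_of_fls_coeff'[OF q])
  qed
qed

instance puiseux :: (comm_ring_1) comm_ring_1
proof
  fix p s u :: "'a puiseux"
  obtain q F G H where q: "q > 0" and [simp]:
    "p = puiseux_of_fls q F" "s = puiseux_of_fls q G" "u = puiseux_of_fls q H"
    by (rule puiseux_as_fls3[of p s u])
  show "p * s * u = p * (s * u)"
    by (simp add: puiseux_of_fls_mult q mult.assoc)
  show "p * s = s * p"
    by (simp add: puiseux_of_fls_mult q mult.commute)
  show "1 * p = p"
    by (subst puiseux_of_fls_1[OF q]) (simp add: puiseux_of_fls_mult q)
  show "(p + s) * u = p * u + s * u"
    by (simp add: puiseux_of_fls_mult puiseux_of_fls_add q algebra_simps)
  show "p + s + u = p + (s + u)" "p + s = s + p" "0 + p = p" "- p + p = 0" "p - s = p + - s"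
    by (rule puiseux_eqI; simp add: algebra_simps)+
  have "puiseux_coeff (0 :: 'a puiseux) 0 \<noteq> puiseux_coeff 1 0" by (simp add: puiseux_coeff_1)
  then show "(0 :: 'a puiseux) \<noteq> 1" by metis
qed

instantiation puiseux :: (field) field
begin

definition inverse_puiseux :: "'a puiseux \<Rightarrow> 'a puiseux" where
  "inverse_puiseux p = (if p = 0 then 0 else (THE s. p * s = 1))"

definition divide_puiseux :: "'a puiseux \<Rightarrow> 'a puiseux \<Rightarrow> 'a puiseux" where
  "divide_puiseux p s = p * inverse s"

instance
proof
  fix p s :: "'a puiseux"
  show "inverse (0 :: 'a puiseux) = 0" by (simp add: inverse_puiseux_def)
  show "p div s = p * inverse s" by (simp add: divide_puiseux_def)
  assume p: "p \<noteq> 0"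
  obtain q F where q: "q > 0" and F: "p = puiseux_of_fls q F"
    by (rule puiseux_as_fls3[of p p p])
  from p F have "F \<noteq> 0" using puiseux_of_fls_0[of q] by metis
  then have ex: "p * puiseux_of_fls q (inverse F) = 1"
    by (simp add: F puiseux_of_fls_mult q puiseux_of_fls_1[OF q])
  have uniq: "v = w" if "p * v = 1" "p * w = 1" for v w
  proof -
    have "v = (p * w) * v" by (simp only: that mult_1)
    also have "\<dots> = w * (p * v)" by (simp only: ac_simps)
    finally show "v = w" by (simp only: that mult_1_right)
  qed
  have "p * (THE s. p * s = 1) = 1"
    by (rule theI[of "\<lambda>v. p * v = 1", OF ex]) (rule uniq[OF _ ex])
  with p have "p * inverse p = 1" by (simp only: inverse_puiseux_def if_False)
  then show "inverse p * p = 1" by (simp add: mult.commute)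
qed

end

subsection \<open>Order and principal coefficient\<close>

text \<open>
  The order is rational-valued and is meaningful for nonzero series only; it is never applied to
  \<open>0\<close> below, so the convention \<open>o(0) = \<infinity>\<close> is not encoded.
\<close>

definition puiseux_order :: "'a::zero puiseux \<Rightarrow> rat" where
  "puiseux_order p = (LEAST r. puiseux_coeff p r \<noteq> 0)"

definition principal_coeff :: "'a::zero puiseux \<Rightarrow> 'a" where
  "principal_coeff p = puiseux_coeff p (puiseux_order p)"

lemma puiseux_order_properties:
  assumes "p \<noteq> 0"
  shows "puiseux_coeff p (puiseux_order p) \<noteq> 0"
    and "\<And>r. puiseux_coeff p r \<noteq> 0 \<Longrightarrow> puiseux_order p \<le> r"
proof -
  obtain q F where q: "q > 0" and F: "p = puiseux_of_fls q F"
    by (rule puiseux_as_fls3[of p p p])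
  from assms F have F0: "F \<noteq> 0" using puiseux_of_fls_0[of q] by metis
  let ?r = "of_int (fls_subdegree F) / of_nat q :: rat"
  have nz: "puiseux_coeff p ?r \<noteq> 0"
    by (simp add: F puiseux_of_fls_coeff' q F0)
  have le: "?r \<le> r" if "puiseux_coeff p r \<noteq> 0" for r
  proof -
    from that q have *: "r * of_nat q \<in> \<int>" "fls_nth F \<lfloor>r * of_nat q\<rfloor> \<noteq> 0"
      by (auto simp: F puiseux_of_fls_coeff split: if_splits)
    then obtain m where m: "r * of_nat q = of_int m" by (auto elim: Ints_cases)
    with * have "fls_subdegree F \<le> m" by (auto intro: fls_subdegree_leI)
    then have "(of_int (fls_subdegree F) :: rat) \<le> r * of_nat q" by (simp add: m)
    with q show ?thesis by (simp add: field_simps)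
  qed
  have "puiseux_order p = ?r"
    unfolding puiseux_order_def using nz le by (rule Least_equality)
  with nz le show "puiseux_coeff p (puiseux_order p) \<noteq> 0"
    "\<And>r. puiseux_coeff p r \<noteq> 0 \<Longrightarrow> puiseux_order p \<le> r" by auto
qed

section \<open>Polynomials in several variables and their tropicalization\<close>

text \<open>
  The variables are indexed by a type \<open>'n\<close>, later assumed finite, so that \<open>n = CARD('n)\<close>.
  The multiplication of \<open>HOL-Library.Poly_Mapping\<close> makes this type the polynomial ring;
  the set \<open>I\<close> of exponents of \<open>f\<close> is \<open>keys f\<close>.
\<close>

type_synonym ('n, 'a) mpoly = "('n \<Rightarrow>\<^sub>0 nat) \<Rightarrow>\<^sub>0 'a"

definition mpoly_eval :: "('n::finite, 'a::comm_semiring_1) mpoly \<Rightarrow> ('n \<Rightarrow> 'a) \<Rightarrow> 'a" where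
  "mpoly_eval f x = (\<Sum>i\<in>Poly_Mapping.keys f. Poly_Mapping.lookup f i *
     (\<Prod>j\<in>UNIV. x j ^ Poly_Mapping.lookup i j))"

definition exponent_pairing :: "('n::finite \<Rightarrow>\<^sub>0 nat) \<Rightarrow> ('n \<Rightarrow> rat) \<Rightarrow> rat" where
  "exponent_pairing i r = (\<Sum>j\<in>UNIV. of_nat (Poly_Mapping.lookup i j) * r j)"

definition tropical_term ::
    "('n::finite, 'a::zero puiseux) mpoly \<Rightarrow> ('n \<Rightarrow>\<^sub>0 nat) \<Rightarrow> ('n \<Rightarrow> rat) \<Rightarrow> rat" where
  "tropical_term f i r = puiseux_order (Poly_Mapping.lookup f i) + exponent_pairing i r"

definition tropical_fun :: "('n::finite, 'a::zero puiseux) mpoly \<Rightarrow> ('n \<Rightarrow> rat) \<Rightarrow> rat" where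
  "tropical_fun f r = Min ((\<lambda>i. tropical_term f i r) ` Poly_Mapping.keys f)"

definition tropical_hypersurface :: "('n::finite, 'a::zero puiseux) mpoly \<Rightarrow> ('n \<Rightarrow> rat) set" where
  "tropical_hypersurface f =
     {r. \<exists>i\<in>Poly_Mapping.keys f. \<exists>i'\<in>Poly_Mapping.keys f. i \<noteq> i' \<and>
           tropical_term f i r = tropical_fun f r \<and> tropical_term f i' r = tropical_fun f r}"

definition initial_poly ::
    "('n::finite, 'a::comm_monoid_add puiseux) mpoly \<Rightarrow> ('n \<Rightarrow> rat) \<Rightarrow> ('n, 'a) mpoly" where
  "initial_poly f b =
     (\<Sum>i | i \<in> Poly_Mapping.keys f \<and> tropical_term f i b = tropical_fun f b.
        Poly_Mapping.single i (principal_coeff (Poly_Mapping.lookup f i)))"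

end

theory Submission
  imports Defs "HOL-Computational_Algebra.Fundamental_Theorem_Algebra"
begin

text \<open>
  Write \<open>a = \<alpha> t\<^sup>c + \<dots>\<close> when \<open>a\<close> has no term of exponent below \<open>c\<close> and its coefficient at \<open>t\<^sup>c\<close> is
  \<open>\<alpha>\<close>, where \<open>\<alpha> = 0\<close> is permitted. This relation, \<open>has_lead c \<alpha> a\<close>, is compatible with sums and
  products, so the value of \<open>f\<close> at a point with coordinates \<open>\<gamma>\<^sub>j t\<^bsup>b\<^sub>j\<^esup> + \<dots>\<close> is \<open>v t\<^bsup>f(b)\<^esup> + \<dots>\<close> with \<open>v\<close>
  the value of the initial polynomial at \<open>\<gamma>\<close> (\<open>has_lead_mpoly_eval\<close>). If \<open>f\<close> vanishes at the point,
  then \<open>v = 0\<close>; since a single monomial cannot vanish at a point with nonzero coordinates, the minimum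
  \<open>f(b)\<close> must then be attained twice (\<open>tropical_point_if_initial_poly_vanishes\<close>).

  For the converse, restrict \<open>f\<close> to the curve \<open>u \<mapsto> (\<gamma>\<^sub>j t\<^bsup>b\<^sub>j\<^esup> u\<^bsup>d\<^sub>j\<^esup>)\<^sub>j\<close> with natural numbers \<open>d\<^sub>j\<close> such that
  distinct exponents \<open>i\<close> of \<open>f\<close> have distinct weights \<open>\<Sum>\<^sub>j d\<^sub>j i\<^sub>j\<close>. After division by \<open>t\<^bsup>f(b)\<^esup>\<close> this gives a
  polynomial \<open>p\<close> in the one variable \<open>u\<close> with coefficients of nonnegative order. Its reduction modulo
  positive powers of \<open>t\<close> is the restriction \<open>h\<close> of the initial polynomial to the curve
  \<open>u \<mapsto> (\<gamma>\<^sub>j u\<^bsup>d\<^sub>j\<^esup>)\<^sub>j\<close>. No two terms of \<open>h\<close> can cancel because the weights are distinct, so \<open>h \<noteq> 0\<close>, and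
  \<open>h(1) = 0\<close> by assumption. A root \<open>u = 1 + \<dots>\<close> of \<open>p\<close> then yields the point sought, because
  multiplication by powers of such a \<open>u\<close> changes neither orders nor principal coefficients.

  The core is therefore the univariate statement \<open>puiseux_root_lift\<close>: every root \<open>\<alpha>\<close> of a nonzero
  reduction \<open>h\<close> lifts to a root \<open>\<alpha> + \<dots>\<close> of \<open>p\<close>. A simple root lifts by Hensel's lemma, applied to power
  series in \<open>t\<^bsup>1/q\<^esup>\<close> for a common denominator \<open>q\<close> of all exponents that occur. A root of multiplicity
  \<open>m > 1\<close> is treated by induction on \<open>m\<close>. It is a simple root of the derivative of order \<open>m - 1\<close> of \<open>h\<close>,
  so a root \<open>s\<^sub>0 = \<alpha> + \<dots>\<close> of the same derivative of \<open>p\<close> exists; shifting by \<open>s\<^sub>0\<close> removes the term of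
  degree \<open>m - 1\<close> from \<open>p\<close>. Unless \<open>s\<^sub>0\<close> is already a root of \<open>p\<close>, rescaling the variable by \<open>t\<^sup>r\<close>, with \<open>-r\<close>
  the slope of the edge of the Newton polygon that ends in degree \<open>m\<close>, produces a polynomial whose
  reduction has degree \<open>m\<close>, at least one lower term, and no term of degree \<open>m - 1\<close>. Such a polynomial is no multiple of \<open>(X - a)\<^sup>m\<close>, so all of its roots have
  multiplicity below \<open>m\<close> and the induction hypothesis applies to any one of them.
\<close>

section \<open>Leading terms of Puiseux series\<close>

text \<open>
  The coefficient \<open>\<alpha>\<close> may vanish; \<open>has_lead c 0 a\<close> says that \<open>a = 0\<close> or \<open>a\<close> has order above \<open>c\<close>. This
  avoids case distinctions when leading terms cancel, and needs no order for the zero series.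
\<close>

definition has_lead :: "rat \<Rightarrow> 'a::zero \<Rightarrow> 'a puiseux \<Rightarrow> bool" where
  "has_lead c \<alpha> a \<longleftrightarrow> (\<forall>r<c. puiseux_coeff a r = 0) \<and> puiseux_coeff a c = \<alpha>"

lemma has_lead_order:
  assumes "a \<noteq> 0"
  shows "has_lead (puiseux_order a) (principal_coeff a) a" "principal_coeff a \<noteq> 0"
  using puiseux_order_properties[OF assms]
  by (auto simp: has_lead_def principal_coeff_def not_less[symmetric])

lemma has_lead_weaken: "has_lead d \<alpha> a \<Longrightarrow> c < d \<Longrightarrow> has_lead c 0 a"
  by (auto simp: has_lead_def)

lemma has_lead_nonzeroD:
  assumes "has_lead c \<alpha> a" "\<alpha> \<noteq> 0"
  shows "a \<noteq> 0" "puiseux_order a = c" "principal_coeff a = \<alpha>"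
proof -
  show "a \<noteq> 0" using assms by (auto simp: has_lead_def)
  show ord: "puiseux_order a = c"
    unfolding puiseux_order_def
    by (rule Least_equality) (use assms in \<open>auto simp: has_lead_def not_less[symmetric]\<close>)
  show "principal_coeff a = \<alpha>"
    using assms by (simp add: principal_coeff_def ord has_lead_def)
qed

lemma has_lead_upto_order:
  "a \<noteq> 0 \<Longrightarrow> c \<le> puiseux_order a \<Longrightarrow> has_lead c (puiseux_coeff a c) a"
  using puiseux_order_properties(2)[of a] by (fastforce simp: has_lead_def)

lemma has_lead_zero_order_gt: "has_lead c 0 a \<Longrightarrow> a \<noteq> 0 \<Longrightarrow> c < puiseux_order a"
  using puiseux_order_properties(1)[of a] by (metis has_lead_def linorder_neqE)

lemma has_lead_zero [simp]: "has_lead c \<alpha> 0 \<longleftrightarrow> \<alpha> = 0"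
  by (auto simp: has_lead_def)

lemma has_lead_one: "has_lead 0 1 1"
  by (auto simp: has_lead_def puiseux_coeff_1)

lemma has_lead_add:
  fixes a a' :: "'a::comm_monoid_add puiseux"
  shows "has_lead c \<alpha> a \<Longrightarrow> has_lead c \<beta> a' \<Longrightarrow> has_lead c (\<alpha> + \<beta>) (a + a')"
  by (auto simp: has_lead_def)

lemma has_lead_sum:
  fixes a :: "'i \<Rightarrow> 'a::comm_ring_1 puiseux"
  assumes "\<And>i. i \<in> A \<Longrightarrow> has_lead c (\<alpha> i) (a i)"
  shows "has_lead c (\<Sum>i\<in>A. \<alpha> i) (\<Sum>i\<in>A. a i)"
  using assms by (induction A rule: infinite_finite_induct) (simp_all add: has_lead_add)

text \<open>
  In the Cauchy product, a pair of exponents \<open>s \<ge> c\<close>, \<open>r - s \<ge> d\<close> exists only if \<open>r \<ge> c + d\<close>, and for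
  \<open>r = c + d\<close> the only pair is \<open>s = c\<close>.
\<close>

lemma has_lead_mult:
  fixes a a' :: "'a::comm_semiring_0 puiseux"
  assumes a: "has_lead c \<alpha> a" and a': "has_lead d \<beta> a'"
  shows "has_lead (c + d) (\<alpha> * \<beta>) (a * a')"
proof -
  have supp: "c \<le> s \<and> d \<le> r - s"
    if "puiseux_coeff a s \<noteq> 0" "puiseux_coeff a' (r - s) \<noteq> 0" for r s
    using that a a' by (auto simp: has_lead_def not_less[symmetric])
  have "puiseux_coeff (a * a') r = 0" if "r < c + d" for r
  proof -
    have "{s. puiseux_coeff a s \<noteq> 0 \<and> puiseux_coeff a' (r - s) \<noteq> 0} = {}"
      using supp[of _ r] that by fastforce
    then show ?thesis by (simp only: puiseux_coeff_mult sum.empty)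
  qed
  moreover have "puiseux_coeff (a * a') (c + d) = \<alpha> * \<beta>"
  proof -
    have "puiseux_coeff (a * a') (c + d) =
        (\<Sum>s\<in>{c}. puiseux_coeff a s * puiseux_coeff a' (c + d - s))"
      unfolding puiseux_coeff_mult
    proof (rule sum.mono_neutral_left)
      show "{s. puiseux_coeff a s \<noteq> 0 \<and> puiseux_coeff a' (c + d - s) \<noteq> 0} \<subseteq> {c}"
        using supp[of _ "c + d"] by fastforce
    qed auto
    then show ?thesis using a a' by (simp add: has_lead_def)
  qed
  ultimately show ?thesis by (simp add: has_lead_def)
qed

lemma has_lead_power:
  fixes a :: "'a::comm_ring_1 puiseux"
  assumes "has_lead c \<alpha> a"
  shows "has_lead (of_nat n * c) (\<alpha> ^ n) (a ^ n)"
proof (induction n)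
  case (Suc n)
  from has_lead_mult[OF assms this] show ?case by (simp add: algebra_simps)
qed (simp add: has_lead_one)

lemma has_lead_prod:
  fixes a :: "'i \<Rightarrow> 'a::comm_ring_1 puiseux"
  assumes "\<And>i. i \<in> A \<Longrightarrow> has_lead (c i) (\<alpha> i) (a i)"
  shows "has_lead (\<Sum>i\<in>A. c i) (\<Prod>i\<in>A. \<alpha> i) (\<Prod>i\<in>A. a i)"
  using assms
  by (induction A rule: infinite_finite_induct) (simp_all add: has_lead_one has_lead_mult)

lemma has_lead_of_nat: "has_lead 0 (of_nat n) (of_nat n :: 'a::comm_ring_1 puiseux)"
  by (induction n) (auto intro: has_lead_add has_lead_one)

instance puiseux :: (field_char_0) field_char_0
proof
  have "of_nat n \<noteq> (0 :: 'a puiseux)" if "n > 0" for n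
    using has_lead_nonzeroD(1)[OF has_lead_of_nat[of n, where ?'a = 'a]] that by simp
  then have "m = n" if "of_nat m = (of_nat n :: 'a puiseux)" "m \<le> n" for m n
    using that by (metis add_diff_cancel_left' le_add_diff_inverse2 le_antisym not_gr_zero of_nat_add
      of_nat_diff diff_is_0_eq cancel_comm_monoid_add_class.diff_cancel)
  then show "inj (of_nat :: nat \<Rightarrow> 'a puiseux)"
    by (metis injI nat_le_linear)
qed

lift_definition puiseux_monom :: "'a::zero \<Rightarrow> rat \<Rightarrow> 'a puiseux" is
  "\<lambda>\<alpha> r s. if s = r then \<alpha> else 0"
proof -
  fix \<alpha> :: 'a and r :: rat
  obtain m n where "quotient_of r = (m, n)" by fastforce
  then have "r = of_int m / of_nat (nat n)" "nat n > 0"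
    using quotient_of_div[of r m n] quotient_of_denom_pos[of r m n] by auto
  then show "\<exists>q k. (0::nat) < q \<and> (\<forall>s. (if s = r then \<alpha> else 0) \<noteq> 0 \<longrightarrow>
      (\<exists>m\<ge>k. s = of_int m / of_nat q))"
    by (intro exI[of _ "nat n"] exI[of _ m]) auto
qed

lemma has_lead_monom: "has_lead r \<alpha> (puiseux_monom \<alpha> r)"
  unfolding has_lead_def by transfer auto

section \<open>Hensel's lemma for power series\<close>

lemma minus_dvd_poly_minus: "x - y dvd poly p x - poly p (y :: 'a::comm_ring_1)"
proof (induction p)
  case (pCons a p)
  have "poly (pCons a p) x - poly (pCons a p) y =
      x * (poly p x - poly p y) + (x - y) * poly p y"
    by (simp add: algebra_simps)
  then show ?case using pCons by simp
qed simp

lemma fps_X_power_dvd_iff: "fps_X ^ n dvd (F :: 'a::comm_ring_1 fps) \<longleftrightarrow> (\<forall>k<n. fps_nth F k = 0)"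
proof
  assume "\<forall>k<n. fps_nth F k = 0"
  then have "F = fps_X ^ n * fps_shift n F"
    by (intro fps_ext) (simp add: fps_X_power_mult_nth)
  then show "fps_X ^ n dvd F" by (rule dvdI)
qed (auto simp: dvd_def fps_X_power_mult_nth)

text \<open>
  Banach's fixed point theorem in the ideal \<open>(X)\<close>: the iterates of \<open>\<phi>\<close> at \<open>0\<close> stabilise coefficientwise,
  and the series of their stable coefficients is a fixed point.
\<close>

lemma fps_contraction_fixpoint:
  fixes \<phi> :: "'a::comm_ring_1 fps \<Rightarrow> 'a fps"
  assumes zero: "\<And>x. fps_X dvd x \<Longrightarrow> fps_X dvd \<phi> x"
    and contr: "\<And>x y n. fps_X dvd x \<Longrightarrow> fps_X dvd y \<Longrightarrow> fps_X ^ n dvd x - y \<Longrightarrow>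
      fps_X ^ Suc n dvd \<phi> x - \<phi> y"
  shows "\<exists>x. fps_X dvd x \<and> \<phi> x = x"
proof -
  define s where "s n = (\<phi> ^^ n) 0" for n
  have s_dvd: "fps_X dvd s n" for n
    by (induction n) (auto simp: s_def zero)
  have step: "fps_X ^ n dvd s (Suc n) - s n" for n
  proof (induction n)
    case (Suc n)
    from contr[OF s_dvd s_dvd Suc] show ?case by (simp add: s_def)
  qed simp
  define x where "x = Abs_fps (\<lambda>k. fps_nth (s (Suc k)) k)"
  have stab: "fps_nth (s (Suc k + j)) k = fps_nth (s (Suc k)) k" for k j
  proof (induction j)
    case (Suc j)
    have "fps_nth (s (Suc (Suc k + j)) - s (Suc k + j)) k = 0"
      using step[of "Suc k + j"] unfolding fps_X_power_dvd_iff by auto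
    with Suc show ?case by simp
  qed simp
  have x: "fps_X ^ n dvd x - s n" for n
    unfolding fps_X_power_dvd_iff
  proof safe
    fix k assume "k < n"
    then obtain j where "n = Suc k + j" using less_imp_Suc_add by fastforce
    with stab[of k j] show "fps_nth (x - s n) k = 0" by (simp add: x_def)
  qed
  have x_dvd: "fps_X dvd x"
    using dvd_add[of fps_X "x - s 1" "s 1"] x[of 1] s_dvd[of 1] by simp
  \<comment> \<open>Both \<open>\<phi> x\<close> and \<open>x\<close> are close to the iterate \<open>s (Suc n) = \<phi> (s n)\<close>, with \<open>n\<close> arbitrary.\<close>
  have "fps_X ^ Suc n dvd \<phi> x - x" for n
  proof -
    have "fps_X ^ Suc n dvd (\<phi> x - \<phi> (s n)) - (x - s (Suc n))"
      by (intro dvd_diff contr x x_dvd s_dvd)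
    then show ?thesis by (simp add: s_def)
  qed
  then have "\<phi> x - x = 0"
    by (intro fps_ext) (metis fps_X_power_dvd_iff lessI fps_zero_nth)
  with x_dvd show ?thesis by auto
qed

text \<open>
  With \<open>P = a + b Y + Y\<^sup>2 R\<close> and \<open>b\<close> a unit, the roots of \<open>P\<close> are the fixed points of
  \<open>x \<mapsto> - (a + x\<^sup>2 R(x)) / b\<close>. This map contracts on the ideal \<open>(X)\<close>: for \<open>x, y \<in> (X)\<close>, the difference of
  \<open>x\<^sup>2 R(x)\<close> and \<open>y\<^sup>2 R(y)\<close> is divisible by \<open>X (x - y)\<close>.
\<close>

lemma fps_hensel:
  fixes P :: "'a::field fps poly"
  assumes c0: "fps_nth (coeff P 0) 0 = 0" and c1: "fps_nth (coeff P 1) 0 \<noteq> 0"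
  shows "\<exists>x. fps_nth x 0 = 0 \<and> poly P x = 0"
proof -
  obtain a b R where P: "P = pCons a (pCons b R)" by (metis pCons_cases)
  have a: "fps_X dvd a" using c0 fps_X_power_dvd_iff[of 1 a] by (simp add: P)
  have b: "b * inverse b = 1" using c1 by (simp add: P inverse_mult_eq_1')
  define \<phi> where "\<phi> x = - inverse b * (a + x\<^sup>2 * poly R x)" for x
  have "\<exists>x. fps_X dvd x \<and> \<phi> x = x"
  proof (rule fps_contraction_fixpoint)
    fix x :: "'a fps" assume "fps_X dvd x"
    then show "fps_X dvd \<phi> x" using a by (simp add: \<phi>_def power2_eq_square)
  next
    fix x y :: "'a fps" and n
    assume x: "fps_X dvd x" and y: "fps_X dvd y" and xy: "fps_X ^ n dvd x - y"
    have "fps_X * fps_X ^ n dvd x * (poly R x - poly R y)"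
      by (rule mult_dvd_mono[OF x dvd_trans[OF xy minus_dvd_poly_minus]])
    moreover have "fps_X * fps_X ^ n dvd (x + y) * (x - y)"
      by (rule mult_dvd_mono[OF dvd_add[OF x y] xy])
    moreover have "\<phi> x - \<phi> y = (- inverse b * x) * (x * (poly R x - poly R y))
        + (- inverse b * poly R y) * ((x + y) * (x - y))"
      by (simp add: \<phi>_def algebra_simps power2_eq_square)
    ultimately show "fps_X ^ Suc n dvd \<phi> x - \<phi> y"
      by (simp only: power_Suc dvd_add dvd_mult)
  qed
  then obtain x where x: "fps_X dvd x" "\<phi> x = x" by blast
  have "poly P x = a + x\<^sup>2 * poly R x + b * x"
    by (simp add: P algebra_simps power2_eq_square)
  also have "b * x = b * \<phi> x" by (simp only: x)
  also have "\<dots> = - (b * inverse b) * (a + x\<^sup>2 * poly R x)" by (simp add: \<phi>_def algebra_simps)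
  finally have "poly P x = 0" by (simp add: b)
  moreover have "fps_nth x 0 = 0" using x(1) fps_X_power_dvd_iff[of 1 x] by simp
  ultimately show ?thesis by blast
qed

section \<open>Puiseux series of nonnegative order as power series\<close>

definition puiseux_of_fps :: "nat \<Rightarrow> 'a::zero fps \<Rightarrow> 'a puiseux" where
  "puiseux_of_fps q F = puiseux_of_fls q (fps_to_fls F)"

lemma puiseux_of_fps_zero [simp]: "puiseux_of_fps q 0 = 0"
  using puiseux_of_fls_0[of q] by (simp add: puiseux_of_fps_def)

lemma puiseux_of_fps_inject: "q > 0 \<Longrightarrow> puiseux_of_fps q F = puiseux_of_fps q G \<longleftrightarrow> F = G"
  using puiseux_of_fls_inj[of q "fps_to_fls F" "fps_to_fls G"] by (auto simp: puiseux_of_fps_def)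

lemma puiseux_of_fps_add: "puiseux_of_fps q (F + G) = puiseux_of_fps q F + puiseux_of_fps q G"
  by (simp add: puiseux_of_fps_def puiseux_of_fls_add)

lemma puiseux_of_fps_mult:
  fixes F G :: "'a::semiring_0 fps"
  shows "q > 0 \<Longrightarrow> puiseux_of_fps q (F * G) = puiseux_of_fps q F * puiseux_of_fps q G"
  by (simp add: puiseux_of_fps_def puiseux_of_fls_mult fls_times_fps_to_fls)

lemma poly_map_puiseux_of_fps:
  fixes P :: "'a::comm_ring_1 fps poly"
  assumes "q > 0"
  shows "poly (map_poly (puiseux_of_fps q) P) (puiseux_of_fps q x) = puiseux_of_fps q (poly P x)"
  by (induction P) (simp_all add: map_poly_pCons puiseux_of_fps_add puiseux_of_fps_mult[OF assms])

lemma has_lead_puiseux_of_fps: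
  assumes "q > 0"
  shows "has_lead 0 (fps_nth F 0) (puiseux_of_fps q F)"
proof -
  have "puiseux_coeff (puiseux_of_fps q F) r = 0" if "r < 0" for r
  proof -
    have "r * of_nat q < 0" using that assms by (simp add: mult_neg_pos)
    then have "\<lfloor>r * of_nat q\<rfloor> < 0" by simp
    then show ?thesis using assms by (simp add: puiseux_of_fps_def puiseux_of_fls_coeff)
  qed
  then show ?thesis
    using assms by (simp add: has_lead_def puiseux_of_fps_def puiseux_of_fls_coeff)
qed

definition integral_denom :: "nat \<Rightarrow> 'a::zero puiseux \<Rightarrow> bool" where
  "integral_denom q a \<longleftrightarrow>
     q > 0 \<and> (\<forall>r. puiseux_coeff a r \<noteq> 0 \<longrightarrow> (\<exists>m\<ge>0. r = of_int m / of_nat q))"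

text \<open>
  Passing to a multiple of the denominator is what makes a common denominator available for finitely
  many series.
\<close>

lemma integral_denom_scale:
  "integral_denom q a \<Longrightarrow> d > 0 \<Longrightarrow> integral_denom (q * d) a"
  unfolding integral_denom_def using support_scale[of d q 0] by auto

lemma integral_denom_exists:
  assumes "has_lead 0 \<alpha> a"
  shows "\<exists>q. integral_denom q a"
proof -
  obtain q k where q: "q > 0" and
    supp: "\<And>r. puiseux_coeff a r \<noteq> 0 \<Longrightarrow> \<exists>m\<ge>k. r = of_int m / of_nat q"
    using puiseux_coeff[of a] by blast
  have "\<exists>m\<ge>0. r = of_int m / of_nat q" if r: "puiseux_coeff a r \<noteq> 0" for r
  proof -
    from supp[OF r] obtain m where m: "r = of_int m / of_nat q" by blast
    have "r \<ge> 0" using r assms by (auto simp: has_lead_def not_less[symmetric])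
    then have "m \<ge> 0" using q by (simp add: m zero_le_divide_iff)
    with m show ?thesis by blast
  qed
  with q show ?thesis unfolding integral_denom_def by blast
qed

lemma integral_denom_fps:
  assumes "integral_denom q a"
  shows "\<exists>F. a = puiseux_of_fps q F"
proof -
  have q: "q > 0" and supp: "\<And>r. puiseux_coeff a r \<noteq> 0 \<Longrightarrow> \<exists>m\<ge>0. r = of_int m / of_nat q"
    using assms by (auto simp: integral_denom_def)
  obtain G where G: "a = puiseux_of_fls q G"
    using puiseux_of_fls_surj[OF q supp] by blast
  have "fls_nth G m = 0" if "m < 0" for m
  proof (rule ccontr)
    assume "fls_nth G m \<noteq> 0"
    then have "puiseux_coeff a (of_int m / of_nat q) \<noteq> 0"
      by (simp add: G puiseux_of_fls_coeff'[OF q])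
    from supp[OF this] q that show False by auto
  qed
  then have "G = fps_to_fls (fls_regpart G)"
    by (intro fls_eqI) (auto simp: not_le)
  with G show ?thesis unfolding puiseux_of_fps_def by metis
qed

section \<open>Reduction of polynomials and simple roots\<close>

text \<open>
  Coefficientwise reduction from the valuation ring of the Puiseux series to its residue field.
\<close>

definition reduces_to :: "'a::zero puiseux poly \<Rightarrow> 'a poly \<Rightarrow> bool" where
  "reduces_to p h \<longleftrightarrow> (\<forall>k. has_lead 0 (coeff h k) (coeff p k))"

lemma reduces_to_pCons [simp]:
  "reduces_to (pCons a p) (pCons \<alpha> h) \<longleftrightarrow> has_lead 0 \<alpha> a \<and> reduces_to p h"
  by (auto simp: reduces_to_def coeff_pCons split: nat.splits)

lemma reduces_to_zero [simp]: "reduces_to 0 0"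
  by (simp add: reduces_to_def)

lemma reduces_to_add:
  fixes p p' :: "'a::comm_ring_1 puiseux poly"
  shows "reduces_to p h \<Longrightarrow> reduces_to p' h' \<Longrightarrow> reduces_to (p + p') (h + h')"
  by (simp add: reduces_to_def has_lead_add)

lemma reduces_to_smult:
  fixes p :: "'a::comm_ring_1 puiseux poly"
  shows "has_lead 0 \<alpha> a \<Longrightarrow> reduces_to p h \<Longrightarrow> reduces_to (smult a p) (smult \<alpha> h)"
  unfolding reduces_to_def using has_lead_mult[of 0 \<alpha> a 0] by fastforce

lemma reduces_to_shift:
  fixes p :: "'a::comm_ring_1 puiseux poly"
  assumes a: "has_lead 0 \<alpha> a" and "reduces_to p h"
  shows "reduces_to (pcompose p [:a, 1:]) (pcompose h [:\<alpha>, 1:])"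
  using assms(2)
proof (induction p arbitrary: h)
  case 0
  then have "h = 0" by (intro poly_eqI) (simp add: reduces_to_def)
  then show ?case by simp
next
  case (pCons c p)
  obtain \<gamma> h' where h: "h = pCons \<gamma> h'" by (rule pCons_cases)
  with pCons have IH: "reduces_to (pcompose p [:a, 1:]) (pcompose h' [:\<alpha>, 1:])"
    and c: "has_lead 0 \<gamma> c" by auto
  show ?case unfolding h pcompose_pCons mult_pCons_left
    by (intro reduces_to_add) (use IH a c in \<open>auto intro: reduces_to_smult\<close>)
qed

lemma reduces_to_higher_pderiv:
  fixes p :: "'a::field_char_0 puiseux poly"
  assumes "reduces_to p h"
  shows "reduces_to ((pderiv ^^ m) p) ((pderiv ^^ m) h)"
  unfolding reduces_to_def
proof
  fix k
  have "has_lead (0 + 0) (of_nat (pochhammer (Suc k) m) * coeff h (k + m))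
      (of_nat (pochhammer (Suc k) m) * coeff p (k + m))"
    by (intro has_lead_mult has_lead_of_nat) (use assms in \<open>auto simp: reduces_to_def\<close>)
  then show "has_lead 0 (coeff ((pderiv ^^ m) h) k) (coeff ((pderiv ^^ m) p) k)"
    by (simp only: coeff_higher_pderiv pochhammer_of_nat add_0)
qed

lemma higher_pderiv_shift:
  fixes p :: "'a::field_char_0 poly"
  shows "(pderiv ^^ m) (pcompose p [:a, 1:]) = pcompose ((pderiv ^^ m) p) [:a, 1:]"
  by (induction m) (simp_all add: pderiv_pcompose pderiv_pCons)

lemma reduces_to_integral_denom:
  fixes p :: "'a::zero puiseux poly"
  assumes "reduces_to p h"
  shows "\<exists>q>0. \<forall>k. integral_denom q (coeff p k)"
  using assms
proof (induction p arbitrary: h)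
  case 0
  show ?case by (rule exI[of _ 1]) (simp add: integral_denom_def)
next
  case (pCons a p)
  obtain \<alpha> h' where h: "h = pCons \<alpha> h'" by (rule pCons_cases)
  from pCons h obtain q where q: "q > 0" "\<And>k. integral_denom q (coeff p k)" by auto
  from pCons.prems h obtain q' where q': "integral_denom q' a"
    using integral_denom_exists by auto
  then have "q' > 0" by (simp add: integral_denom_def)
  have "integral_denom (q * q') (coeff (pCons a p) k)" for k
    using integral_denom_scale[OF q(2) \<open>q' > 0\<close>] integral_denom_scale[OF q' q(1)]
    by (auto simp: coeff_pCons mult.commute split: nat.splits)
  with q(1) \<open>q' > 0\<close> show ?case by (intro exI[of _ "q * q'"]) simp
qed

text \<open>
  The hypotheses say that \<open>\<alpha>\<close> is a simple root of \<open>h\<close>. Multiplicities are read off here and below from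
  the coefficients of \<open>h(X + \<alpha>)\<close>. After the shift by \<open>\<alpha>\<close> the root sought has positive order, and a
  common denominator of the coefficients reduces the claim to \<open>fps_hensel\<close>.
\<close>

lemma puiseux_hensel:
  fixes p :: "'a::field_char_0 puiseux poly"
  assumes red: "reduces_to p h"
    and c0: "coeff (pcompose h [:\<alpha>, 1:]) 0 = 0" and c1: "coeff (pcompose h [:\<alpha>, 1:]) 1 \<noteq> 0"
  shows "\<exists>s. has_lead 0 \<alpha> s \<and> poly p s = 0"
proof -
  let ?a = "puiseux_monom \<alpha> 0"
  let ?p = "pcompose p [:?a, 1:]" and ?h = "pcompose h [:\<alpha>, 1:]"
  have red': "reduces_to ?p ?h" by (rule reduces_to_shift[OF has_lead_monom red])
  then obtain q where q: "q > 0" and "\<And>k. integral_denom q (coeff ?p k)"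
    using reduces_to_integral_denom by blast
  then have "\<forall>k. \<exists>F. coeff ?p k = puiseux_of_fps q F" using integral_denom_fps by blast
  then obtain F where F: "\<And>k. coeff ?p k = puiseux_of_fps q (F k)" by metis
  have F_eq: "fps_nth (F k) 0 = coeff ?h k" for k
    using has_lead_puiseux_of_fps[OF q, of "F k"] red'
    by (simp add: has_lead_def reduces_to_def F[symmetric])
  have F0: "F k = 0" if "k > degree ?p" for k
    using that by (simp add: puiseux_of_fps_inject[OF q, symmetric] F[symmetric] coeff_eq_0)
  define P where "P = (\<Sum>k\<le>degree ?p. monom (F k) k)"
  have P: "coeff P k = F k" for k
    using F0[of k] by (auto simp: P_def coeff_sum not_le)
  have p_eq: "?p = map_poly (puiseux_of_fps q) P"
    by (intro poly_eqI) (simp add: coeff_map_poly F P)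
  obtain x where x: "fps_nth x 0 = 0" "poly P x = 0"
    using fps_hensel[of P] c0 c1 F_eq P by auto
  have "poly ?p (puiseux_of_fps q x) = 0"
    using x(2) by (simp add: p_eq poly_map_puiseux_of_fps[OF q])
  then have "poly p (?a + puiseux_of_fps q x) = 0"
    by (simp add: poly_pcompose)
  moreover have "has_lead 0 (\<alpha> + 0) (?a + puiseux_of_fps q x)"
    using has_lead_puiseux_of_fps[OF q, of x] x(1) by (intro has_lead_add has_lead_monom) simp
  ultimately show ?thesis by auto
qed

section \<open>Lifting of multiple roots\<close>

lemma pochhammer_of_nat_Suc_nonzero [simp]:
  "pochhammer (of_nat (Suc n) :: 'a::field_char_0) m \<noteq> 0"
  by (metis of_nat_0_eq_iff pochhammer_of_nat pochhammer_pos less_irrefl zero_less_Suc)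

text \<open>
  The derivative of order \<open>m - 1\<close> of \<open>h\<close> is \<open>c X\<close> with \<open>c \<noteq> 0\<close>. A root \<open>a\<close> of multiplicity \<open>m\<close> would be a
  root of it, hence \<open>a = 0\<close>, and then \<open>h\<close> could have no term of degree below \<open>m\<close>.
\<close>

lemma no_full_multiplicity_root:
  fixes h :: "'a::field_char_0 poly"
  assumes deg: "degree h = m" and m: "m > 0" and c: "coeff h (m - 1) = 0"
    and k: "k < m" "coeff h k \<noteq> 0"
  shows "\<exists>l<m. coeff (pcompose h [:a, 1:]) l \<noteq> 0"
proof (rule ccontr)
  assume "\<not> ?thesis"
  then have low: "coeff (pcompose h [:a, 1:]) l = 0" if "l < m" for l using that by blast
  let ?L = "(pderiv ^^ (m - 1)) h"
  have L: "coeff ?L l = (if l = 1 then coeff ?L 1 else 0)" for l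
    using c m deg by (cases l) (auto simp: coeff_higher_pderiv intro!: coeff_eq_0)
  have L_eq: "?L = monom (coeff ?L 1) 1"
    by (rule poly_eqI) (subst L, simp)
  have lead: "coeff h m \<noteq> 0" using deg m by auto
  have "poly ?L a = coeff ((pderiv ^^ (m - 1)) (pcompose h [:a, 1:])) 0"
    by (simp add: higher_pderiv_shift)
  also have "\<dots> = 0" using low[of "m - 1"] m by (simp add: coeff_higher_pderiv)
  finally have "coeff ?L 1 * a = 0" by (subst (asm) L_eq) (simp add: poly_monom)
  moreover have "coeff ?L 1 \<noteq> 0"
    using lead m pochhammer_of_nat_Suc_nonzero[of 1 "m - 1", where ?'a = 'a]
    by (simp add: coeff_higher_pderiv)
  ultimately have "a = 0" by simp
  with low[OF k(1)] k(2) show False by simp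
qed

text \<open>
  The last hypothesis bounds the multiplicity of \<open>\<alpha>\<close> as a root of \<open>h\<close> by \<open>m\<close>. With a
  bound in place of an equality, any nonzero coefficient of \<open>h(X + \<alpha>)\<close> of degree below \<open>m\<close> already gives
  access to the induction hypothesis, and the least such degree never has to be singled out.
\<close>

lemma puiseux_root_lift:
  fixes p :: "'a::{alg_closed_field, field_char_0} puiseux poly"
  assumes "reduces_to p h" "poly h \<alpha> = 0" "coeff (pcompose h [:\<alpha>, 1:]) m \<noteq> 0"
  shows "\<exists>s. has_lead 0 \<alpha> s \<and> poly p s = 0"
  using assms
proof (induction m arbitrary: p h \<alpha> rule: less_induct)
  case (less m)
  let ?h = "pcompose h [:\<alpha>, 1:]"
  show ?case
  proof (cases "\<exists>k<m. coeff ?h k \<noteq> 0")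
    case True
    then show ?thesis using less by blast
  next
    case False
    then have low: "coeff ?h k = 0" if "k < m" for k using that by blast
    have m: "m > 0" using less.prems by (cases m) auto
    \<comment> \<open>The multiplicity is exactly \<open>m\<close>, so \<open>\<alpha>\<close> is a simple root of the derivative of order \<open>m - 1\<close>.\<close>
    have "\<exists>s. has_lead 0 \<alpha> s \<and> poly ((pderiv ^^ (m - 1)) p) s = 0"
    proof (rule puiseux_hensel[OF reduces_to_higher_pderiv[OF less.prems(1)]])
      show "coeff (pcompose ((pderiv ^^ (m - 1)) h) [:\<alpha>, 1:]) 0 = 0"
        using low[of "m - 1"] m
        by (simp only: higher_pderiv_shift[symmetric] coeff_higher_pderiv) simp
      show "coeff (pcompose ((pderiv ^^ (m - 1)) h) [:\<alpha>, 1:]) 1 \<noteq> 0"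
        using less.prems(3) m pochhammer_of_nat_Suc_nonzero[of 1 "m - 1", where ?'a = 'a]
        by (simp only: higher_pderiv_shift[symmetric] coeff_higher_pderiv) simp
    qed
    then obtain s0 where s0: "has_lead 0 \<alpha> s0" "poly ((pderiv ^^ (m - 1)) p) s0 = 0" by blast
    define p1 where "p1 = pcompose p [:s0, 1:]"
    have red1: "reduces_to p1 ?h"
      unfolding p1_def by (rule reduces_to_shift[OF s0(1) less.prems(1)])
    have "coeff ((pderiv ^^ (m - 1)) p1) 0 = 0"
      using s0(2) by (simp add: p1_def higher_pderiv_shift)
    then have p1_sub: "coeff p1 (m - 1) = 0"
      using pochhammer_of_nat_Suc_nonzero[of 0 "m - 1", where ?'a = "'a puiseux"]
      by (simp add: coeff_higher_pderiv)
    show ?thesis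
    proof (cases "coeff p1 0 = 0")
      case True
      then show ?thesis using s0(1) by (auto simp: p1_def)
    next
      case nz: False
      \<comment> \<open>Each nonzero coefficient of degree \<open>k < m\<close> gives the point \<open>(k, order of coeff p1 k)\<close> of the
        Newton polygon, and the coefficient of degree \<open>m\<close> gives \<open>(m, 0)\<close>; the number
        \<open>r\<close> is the negated slope of the edge that ends in \<open>(m, 0)\<close>.\<close>
      define A where "A = {k. k < m \<and> coeff p1 k \<noteq> 0}"
      define slope where "slope k = puiseux_order (coeff p1 k) / of_nat (m - k)" for k
      define r where "r = Min (slope ` A)"
      have fin: "finite A" and ne: "A \<noteq> {}" using nz m by (auto simp: A_def)
      have "slope k > 0" if "k \<in> A" for k
      proof -
        have "has_lead 0 0 (coeff p1 k)"
          using red1 low[of k] that unfolding reduces_to_def A_def by (metis (lifting) mem_Collect_eq)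
        then show ?thesis
          using that has_lead_zero_order_gt by (fastforce simp: slope_def A_def intro!: divide_pos_pos)
      qed
      then have r: "r > 0" using fin ne by (simp add: r_def)
      obtain k0 where k0: "k0 \<in> A" "r = slope k0"
        using Min_in[of "slope ` A"] fin ne unfolding r_def by blast
      \<comment> \<open>Reduction of \<open>t\<^bsup>-mr\<^esup> p1(t\<^sup>r X)\<close>: a coefficient below \<open>m\<close> survives exactly if its point lies on the
        edge, and those above \<open>m\<close> acquire the positive order \<open>(k - m) r\<close> at least.\<close>
      define \<beta> where "\<beta> k = (if k < m then puiseux_coeff (coeff p1 k) (of_nat (m - k) * r)
          else coeff ?h m)" for k
      define h2 where "h2 = (\<Sum>k\<le>m. monom (\<beta> k) k)"
      have h2: "coeff h2 k = (if k \<le> m then \<beta> k else 0)" for k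
        by (simp add: h2_def coeff_sum)
      have lead: "has_lead ((of_nat m - of_nat k) * r) (coeff h2 k) (coeff p1 k)" for k
      proof -
        consider "k < m" "coeff p1 k = 0" | "k \<in> A" | "k = m" | "k > m"
          unfolding A_def by fastforce
        then show ?thesis
        proof cases
          case 1
          then show ?thesis by (simp add: h2 \<beta>_def)
        next
          case 2
          then have k: "k < m" "coeff p1 k \<noteq> 0" by (auto simp: A_def)
          have "r \<le> slope k" using 2 fin by (simp add: r_def)
          then have "of_nat (m - k) * r \<le> puiseux_order (coeff p1 k)"
            using k(1) by (simp add: slope_def field_simps)
          from has_lead_upto_order[OF k(2) this] k(1) show ?thesis
            by (simp add: h2 \<beta>_def of_nat_diff)
        next
          case 3
          then show ?thesis using red1 by (simp add: h2 \<beta>_def reduces_to_def)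
        next
          case 4
          then have "(of_nat m - of_nat k) * r < 0" using r by (simp add: mult_neg_pos)
          then show ?thesis
            using has_lead_weaken[of 0 "coeff ?h k" "coeff p1 k"] red1 4
            by (auto simp: h2 reduces_to_def)
        qed
      qed
      define T where "T = puiseux_monom (1::'a) r"
      define p2 where "p2 = smult (puiseux_monom 1 (- (of_nat m * r))) (pcompose p1 [:0, T:])"
      have red2: "reduces_to p2 h2"
        unfolding reduces_to_def
      proof
        fix k
        have "has_lead (- (of_nat m * r) + (of_nat k * r + (of_nat m - of_nat k) * r))
            (1 * (1 ^ k * coeff h2 k))
            (puiseux_monom 1 (- (of_nat m * r)) * (T ^ k * coeff p1 k))"
          unfolding T_def by (intro has_lead_mult has_lead_power has_lead_monom lead)
        then show "has_lead 0 (coeff h2 k) (coeff p2 k)"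
          by (simp add: p2_def coeff_pcompose_linear algebra_simps)
      qed
      have "coeff h2 m \<noteq> 0" using less.prems(3) by (simp add: h2 \<beta>_def)
      moreover have "degree h2 \<le> m" by (rule degree_le) (simp add: h2)
      ultimately have deg: "degree h2 = m" by (simp add: le_antisym le_degree)
      then obtain a where a: "poly h2 a = 0"
        using alg_closed_imp_poly_has_root[of h2] m by auto
      have "\<exists>l<m. coeff (pcompose h2 [:a, 1:]) l \<noteq> 0"
      proof (rule no_full_multiplicity_root[OF deg m])
        show "coeff h2 (m - 1) = 0" using m p1_sub by (simp add: h2 \<beta>_def)
        show "k0 < m" using k0 by (simp add: A_def)
        have "of_nat (m - k0) * r = puiseux_order (coeff p1 k0)"
          using k0 by (simp add: slope_def A_def)
        then show "coeff h2 k0 \<noteq> 0"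
          using k0 puiseux_order_properties(1)[of "coeff p1 k0"] by (simp add: A_def h2 \<beta>_def)
      qed
      then obtain u where u: "has_lead 0 a u" "poly p2 u = 0"
        using less.IH[OF _ red2 a] by blast
      have "puiseux_monom (1::'a) (- (of_nat m * r)) \<noteq> 0"
        by (rule has_lead_nonzeroD(1)[OF has_lead_monom]) simp
      then have root: "poly p (s0 + u * T) = 0"
        using u(2) by (simp add: p2_def p1_def poly_pcompose)
      have "has_lead (0 + r) (a * 1) (u * T)"
        unfolding T_def by (intro has_lead_mult has_lead_monom u)
      then have "has_lead 0 0 (u * T)" using r has_lead_weaken by fastforce
      from has_lead_add[OF s0(1) this] root show ?thesis by auto
    qed
  qed
qed

section \<open>Curves that separate monomials\<close>

text \<open>
  The weights are the powers of \<open>N\<close>, so that the entries of a vector are the digits of its weighted sum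
  in base \<open>N\<close>.
\<close>

lemma weights_separating_bounded_vectors:
  fixes N :: nat
  assumes "finite A"
  shows "\<exists>d::'n \<Rightarrow> nat. \<forall>v w. (\<forall>j\<in>A. v j < N \<and> w j < N) \<longrightarrow>
     (\<Sum>j\<in>A. d j * v j) = (\<Sum>j\<in>A. d j * w j) \<longrightarrow> (\<forall>j\<in>A. v j = w j)"
  using assms
proof (induction A)
  case (insert a A)
  then obtain d :: "'n \<Rightarrow> nat" where
    d: "\<And>v w. (\<forall>j\<in>A. v j < N \<and> w j < N) \<Longrightarrow>
      (\<Sum>j\<in>A. d j * v j) = (\<Sum>j\<in>A. d j * w j) \<Longrightarrow> (\<forall>j\<in>A. v j = w j)" by blast
  define e where "e j = (if j = a then 1 else N * d j)" for j
  have e: "(\<Sum>j\<in>insert a A. e j * v j) = v a + N * (\<Sum>j\<in>A. d j * v j)" for v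
  proof -
    have "(\<Sum>j\<in>A. e j * v j) = N * (\<Sum>j\<in>A. d j * v j)"
      unfolding sum_distrib_left by (rule sum.cong) (use insert in \<open>auto simp: e_def\<close>)
    then show ?thesis using insert by (simp add: e_def)
  qed
  show ?case
  proof (intro exI[of _ e] allI impI)
    fix v w
    assume bd: "\<forall>j\<in>insert a A. v j < N \<and> w j < N"
      and eq: "(\<Sum>j\<in>insert a A. e j * v j) = (\<Sum>j\<in>insert a A. e j * w j)"
    have mod: "(x + N * y) mod N = x" if "x < N" for x y using that by simp
    have a: "v a = w a" using eq bd mod unfolding e by (metis insertI1)
    have "N > 0" using bd by auto
    with eq a have "(\<Sum>j\<in>A. d j * v j) = (\<Sum>j\<in>A. d j * w j)" unfolding e by simp
    with d[of v w] bd a show "\<forall>j\<in>insert a A. v j = w j" by simp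
  qed
qed simp

lemma weights_separating_exponents:
  fixes S :: "('n::finite \<Rightarrow>\<^sub>0 nat) set"
  assumes "finite S"
  shows "\<exists>d::'n \<Rightarrow> nat. inj_on (\<lambda>i. \<Sum>j\<in>UNIV. d j * Poly_Mapping.lookup i j) S"
proof -
  have "finite (\<Union>i\<in>S. range (Poly_Mapping.lookup i))" using assms by auto
  then obtain N where "\<forall>n\<in>(\<Union>i\<in>S. range (Poly_Mapping.lookup i)). n < N"
    unfolding finite_nat_set_iff_bounded by blast
  then have N: "Poly_Mapping.lookup i j < N" if "i \<in> S" for i j using that by blast
  obtain d :: "'n \<Rightarrow> nat" where
    d: "\<And>v w. (\<forall>j\<in>UNIV. v j < N \<and> w j < N) \<Longrightarrow>
     (\<Sum>j\<in>UNIV. d j * v j) = (\<Sum>j\<in>UNIV. d j * w j) \<Longrightarrow> (\<forall>j\<in>UNIV. v j = w j)"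
    using weights_separating_bounded_vectors[of UNIV N, OF finite] by blast
  have "inj_on (\<lambda>i. \<Sum>j\<in>UNIV. d j * Poly_Mapping.lookup i j) S"
    by (rule inj_onI) (use d N in \<open>blast intro: poly_mapping_eqI\<close>)
  then show ?thesis by blast
qed

section \<open>Initial polynomials and zeros of the polynomial\<close>

abbreviation eval_monomial :: "('n::finite \<Rightarrow>\<^sub>0 nat) \<Rightarrow> ('n \<Rightarrow> 'a) \<Rightarrow> 'a::comm_semiring_1" where
  "eval_monomial i x \<equiv> (\<Prod>j\<in>UNIV. x j ^ Poly_Mapping.lookup i j)"

definition initial_term ::
    "('n::finite, 'a::comm_ring_1 puiseux) mpoly \<Rightarrow> ('n \<Rightarrow> rat) \<Rightarrow> ('n \<Rightarrow> 'a) \<Rightarrow>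
      ('n \<Rightarrow>\<^sub>0 nat) \<Rightarrow> 'a" where
  "initial_term f b \<gamma> i = (if tropical_term f i b = tropical_fun f b
     then principal_coeff (Poly_Mapping.lookup f i) * eval_monomial i \<gamma> else 0)"

lemma has_lead_term:
  fixes f :: "('n::finite, 'a::comm_ring_1 puiseux) mpoly"
  assumes i: "i \<in> Poly_Mapping.keys f" and x: "\<And>j. has_lead (b j) (\<gamma> j) (x j)"
  shows "has_lead (tropical_fun f b) (initial_term f b \<gamma> i)
      (Poly_Mapping.lookup f i * eval_monomial i x)"
proof -
  have "has_lead (tropical_term f i b)
      (principal_coeff (Poly_Mapping.lookup f i) * eval_monomial i \<gamma>)
      (Poly_Mapping.lookup f i * eval_monomial i x)"
    unfolding tropical_term_def exponent_pairing_def
    by (intro has_lead_mult has_lead_order has_lead_prod has_lead_power x)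
      (use i in \<open>simp add: in_keys_iff\<close>)
  moreover have "tropical_fun f b \<le> tropical_term f i b"
    unfolding tropical_fun_def using i by simp
  ultimately show ?thesis
    using has_lead_weaken
    by (cases "tropical_fun f b = tropical_term f i b") (force simp: initial_term_def)+
qed

lemma mpoly_eval_initial_poly:
  fixes f :: "('n::finite, 'a::comm_ring_1 puiseux) mpoly"
  shows "mpoly_eval (initial_poly f b) \<gamma> = (\<Sum>i\<in>Poly_Mapping.keys f. initial_term f b \<gamma> i)"
proof -
  let ?I = "{i. i \<in> Poly_Mapping.keys f \<and> tropical_term f i b = tropical_fun f b}"
  have look: "Poly_Mapping.lookup (initial_poly f b) i =
      (if i \<in> ?I then principal_coeff (Poly_Mapping.lookup f i) else 0)" for i
    by (simp add: initial_poly_def lookup_sum lookup_single when_def)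
  have "Poly_Mapping.keys (initial_poly f b) = ?I"
  proof (rule set_eqI)
    fix i
    show "i \<in> Poly_Mapping.keys (initial_poly f b) \<longleftrightarrow> i \<in> ?I"
      using has_lead_order(2)[of "Poly_Mapping.lookup f i"] by (simp add: in_keys_iff look)
  qed
  then show ?thesis
    unfolding mpoly_eval_def
    by (auto simp: look initial_term_def sum.If_cases Int_def intro!: sum.cong)
qed

lemma initial_term_eq_0_iff:
  fixes f :: "('n::finite, 'a::field puiseux) mpoly"
  assumes "i \<in> Poly_Mapping.keys f" "\<And>j. \<gamma> j \<noteq> 0"
  shows "initial_term f b \<gamma> i = 0 \<longleftrightarrow> tropical_term f i b \<noteq> tropical_fun f b"
  using assms has_lead_order(2)[of "Poly_Mapping.lookup f i"]
  by (simp add: initial_term_def in_keys_iff)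

lemma has_lead_mpoly_eval:
  fixes f :: "('n::finite, 'a::comm_ring_1 puiseux) mpoly"
  assumes "\<And>j. has_lead (b j) (\<gamma> j) (x j)"
  shows "has_lead (tropical_fun f b) (mpoly_eval (initial_poly f b) \<gamma>) (mpoly_eval f x)"
  unfolding mpoly_eval_initial_poly unfolding mpoly_eval_def
  by (intro has_lead_sum has_lead_term assms)

lemma tropical_fun_attained:
  fixes f :: "('n::finite, 'a::comm_ring_1 puiseux) mpoly"
  assumes "f \<noteq> 0"
  shows "\<exists>i\<in>Poly_Mapping.keys f. tropical_term f i b = tropical_fun f b"
  using Min_in[of "(\<lambda>i. tropical_term f i b) ` Poly_Mapping.keys f"] assms
  unfolding tropical_fun_def by fastforce

lemma tropical_point_if_initial_poly_vanishes:
  fixes f :: "('n::finite, 'a::field puiseux) mpoly"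
  assumes f: "f \<noteq> 0" and \<gamma>: "\<And>j. \<gamma> j \<noteq> 0" and zero: "mpoly_eval (initial_poly f b) \<gamma> = 0"
  shows "b \<in> tropical_hypersurface f"
proof (rule ccontr)
  assume b: "b \<notin> tropical_hypersurface f"
  obtain i where i: "i \<in> Poly_Mapping.keys f" "tropical_term f i b = tropical_fun f b"
    using tropical_fun_attained[OF f] by blast
  then have "tropical_term f i' b \<noteq> tropical_fun f b"
    if "i' \<in> Poly_Mapping.keys f" "i' \<noteq> i" for i'
    using b that by (auto simp: tropical_hypersurface_def)
  then have "mpoly_eval (initial_poly f b) \<gamma> = (\<Sum>i'\<in>{i}. initial_term f b \<gamma> i')"
    unfolding mpoly_eval_initial_poly using i
    by (intro sum.mono_neutral_right) (auto simp: initial_term_eq_0_iff[OF _ \<gamma>])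
  then show False
    using zero i by (simp add: initial_term_eq_0_iff[OF _ \<gamma>])
qed

text \<open>
  The point sought is \<open>(\<gamma>\<^sub>j t\<^bsup>b\<^sub>j\<^esup> u\<^bsup>d\<^sub>j\<^esup>)\<^sub>j\<close> for a root \<open>u = 1 + \<dots>\<close> of the restriction \<open>p\<close> of \<open>t\<^bsup>-f(b)\<^esup> f\<close>
  to the curve with this parametrization.
  Monomials of \<open>f\<close> with distinct exponents restrict to distinct powers of \<open>u\<close>, which keeps the
  reduction \<open>h\<close> of \<open>p\<close> nonzero.
\<close>

lemma lift_zero_of_initial_poly:
  fixes f :: "('n::finite, 'a::{alg_closed_field, field_char_0} puiseux) mpoly"
  assumes f: "f \<noteq> 0" and \<gamma>: "\<And>j. \<gamma> j \<noteq> 0" and zero: "mpoly_eval (initial_poly f b) \<gamma> = 0"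
  shows "\<exists>x. (\<forall>j. has_lead (b j) (\<gamma> j) (x j)) \<and> mpoly_eval f x = 0"
proof -
  obtain d :: "'n \<Rightarrow> nat" where
    inj: "inj_on (\<lambda>i. \<Sum>j\<in>UNIV. d j * Poly_Mapping.lookup i j) (Poly_Mapping.keys f)"
    using weights_separating_exponents[OF finite_keys] by blast
  define D where "D i = (\<Sum>j\<in>UNIV. d j * Poly_Mapping.lookup i j)" for i
  define c where "c j = puiseux_monom (\<gamma> j) (b j)" for j
  define \<tau> where "\<tau> = puiseux_monom (1::'a) (- tropical_fun f b)"
  define p where "p = (\<Sum>i\<in>Poly_Mapping.keys f.
      monom (\<tau> * (Poly_Mapping.lookup f i * eval_monomial i c)) (D i))"
  define h where "h = (\<Sum>i\<in>Poly_Mapping.keys f. monom (initial_term f b \<gamma> i) (D i))"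
  have c: "has_lead (b j) (\<gamma> j) (c j)" for j
    unfolding c_def by (rule has_lead_monom)
  have lead: "has_lead 0 (initial_term f b \<gamma> i) (\<tau> * (Poly_Mapping.lookup f i * eval_monomial i c))"
    if "i \<in> Poly_Mapping.keys f" for i
    using has_lead_mult[OF has_lead_monom[of "- tropical_fun f b" 1]
        has_lead_term[where b = b, OF that c]]
    by (simp add: \<tau>_def)
  have red: "reduces_to p h"
    unfolding reduces_to_def p_def h_def coeff_sum
    by (intro allI has_lead_sum) (auto simp: lead)
  obtain i where i: "i \<in> Poly_Mapping.keys f" "tropical_term f i b = tropical_fun f b"
    using tropical_fun_attained[OF f] by blast
  have "coeff h (D i) = (\<Sum>i'\<in>Poly_Mapping.keys f. if i' = i then initial_term f b \<gamma> i' else 0)"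
    unfolding h_def coeff_sum
    by (rule sum.cong) (use inj i in \<open>auto simp: inj_on_def D_def\<close>)
  then have "coeff h (D i) = initial_term f b \<gamma> i" using i by simp
  also have "\<dots> \<noteq> 0"
    using i by (simp add: initial_term_eq_0_iff[OF _ \<gamma>])
  finally have "h \<noteq> 0" by auto
  then have "pcompose h [:1, 1:] \<noteq> 0" using pcompose_eq_0[of h "[:1, 1:]"] by auto
  then obtain m where m: "coeff (pcompose h [:1, 1:]) m \<noteq> 0" using leading_coeff_neq_0 by blast
  have root: "poly h 1 = 0"
    using zero unfolding mpoly_eval_initial_poly by (simp add: h_def poly_sum poly_monom)
  obtain u where u: "has_lead 0 1 u" "poly p u = 0"
    using puiseux_root_lift[OF red root m] by blast
  define x where "x j = c j * u ^ d j" for j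
  have "has_lead (b j + of_nat (d j) * 0) (\<gamma> j * 1 ^ d j) (x j)" for j
    unfolding x_def by (intro has_lead_mult has_lead_power c u)
  then have x: "has_lead (b j) (\<gamma> j) (x j)" for j by simp
  have "poly p u = \<tau> * mpoly_eval f x"
    by (simp add: p_def mpoly_eval_def poly_sum poly_monom x_def D_def sum_distrib_left
        power_mult_distrib prod.distrib power_sum power_mult mult.assoc)
  moreover have "\<tau> \<noteq> 0"
    unfolding \<tau>_def by (rule has_lead_nonzeroD(1)[OF has_lead_monom]) simp
  ultimately have "mpoly_eval f x = 0" using u(2) by simp
  with x show ?thesis by blast
qed

theorem theorem1p3:
  fixes f :: "('n::finite, complex puiseux) mpoly"
    and \<gamma> :: "'n \<Rightarrow> complex"
    and b :: "'n \<Rightarrow> rat"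
  assumes "f \<noteq> 0"
    and "\<forall>j. \<gamma> j \<noteq> 0"
  shows "(\<exists>b' :: 'n \<Rightarrow> complex puiseux.
            (\<forall>j. b' j \<noteq> 0) \<and> mpoly_eval f b' = 0 \<and>
            (\<forall>j. principal_coeff (b' j) = \<gamma> j \<and> puiseux_order (b' j) = b j))
         \<longleftrightarrow> b \<in> tropical_hypersurface f \<and> mpoly_eval (initial_poly f b) \<gamma> = 0"
proof
  assume "\<exists>b' :: 'n \<Rightarrow> complex puiseux. (\<forall>j. b' j \<noteq> 0) \<and> mpoly_eval f b' = 0 \<and>
            (\<forall>j. principal_coeff (b' j) = \<gamma> j \<and> puiseux_order (b' j) = b j)"
  then obtain b' where nz: "\<And>j. b' j \<noteq> 0" and root: "mpoly_eval f b' = 0"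
    and b': "\<And>j. principal_coeff (b' j) = \<gamma> j" "\<And>j. puiseux_order (b' j) = b j" by blast
  have "has_lead (b j) (\<gamma> j) (b' j)" for j
    using has_lead_order(1)[OF nz[of j]] by (simp add: b')
  from has_lead_mpoly_eval[where f = f and b = b, OF this] root
  have "mpoly_eval (initial_poly f b) \<gamma> = 0" by simp
  with tropical_point_if_initial_poly_vanishes assms
  show "b \<in> tropical_hypersurface f \<and> mpoly_eval (initial_poly f b) \<gamma> = 0" by blast
next
  assume "b \<in> tropical_hypersurface f \<and> mpoly_eval (initial_poly f b) \<gamma> = 0"
  then obtain b' where lead: "\<And>j. has_lead (b j) (\<gamma> j) (b' j)" and "mpoly_eval f b' = 0"
    using lift_zero_of_initial_poly[of f \<gamma> b] assms by blast
  then show "\<exists>b' :: 'n \<Rightarrow> complex puiseux. (\<forall>j. b' j \<noteq> 0) \<and> mpoly_eval f b' = 0 \<and>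
            (\<forall>j. principal_coeff (b' j) = \<gamma> j \<and> puiseux_order (b' j) = b j)"
    using has_lead_nonzeroD[OF lead] assms(2) by (intro exI[of _ b']) auto
qed

end
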